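(* Let $0<\beta<1$ and $q=1/(1-\beta)$. There is a sequence $\{f_j\}_{j\ge1}\subset BV(\mathbb{R})$ and a function $f\in BV(\mathbb{R})$ such that $\|f_j-f\|_{BV(\mathbb{R})}\to0$ as $j\to\infty$ but $\mathrm{Var}_q\big(M_\beta f_j - M_\beta f\big)\not\to0$ as $j\to\infty$.
   Context: $BV(\mathbb{R})$ is the space of functions $f:\mathbb{R}\to\mathbb{R}$ of bounded total variation $\mathrm{Var}(f)$, with norm $\|f\|_{BV(\mathbb{R})} = |f(-\infty)| + \mathrm{Var}(f)$, where $f(-\infty)=\lim_{x\to-\infty}f(x)$. The centered fractional maximal operator in dimension one is $$M_\beta f(x)=\sup_{r>0}\frac{1}{(2r)^{1-\beta}}\int_{x-r}^{x+r}|f(y)|\,dy.$$ For $g:\mathbb{R}\to\mathbb{R}$ and $1\le q<\infty$ the Riesz $q$-variation (with values in $[0,\infty]$) is $$\mathrm{Var}_q(g) = \sup_{\mathcal{P}}\left(\sum_{n=1}^{N-1}\frac{|g(x_{n+1})-g(x_n)|^q}{|x_{n+1}-x_n|^{q-1}}\right)^{1/q},$$ the supremum over all finite partitions $\mathcal{P}=\{x_1<x_2<\cdots<x_N\}$. The existence of $\mathrm{Var}_q(M_\beta f_j-M_\beta f)$ includes that $M_\beta f_j$ and $M_\beta f$ are finite-valued. *)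

theory Defs
  imports "HOL-Analysis.Analysis"
begin

text \<open>
  A finite partition \<open>x\<^sub>1 < \<dots> < x\<^sub>N\<close> is a pair \<open>(N, x)\<close>; the values of \<open>x\<close> outside
  \<open>{1..N}\<close> are irrelevant.
\<close>

definition partitions :: "(nat \<times> (nat \<Rightarrow> real)) set" where
  "partitions = {(N, x). N \<ge> 1 \<and> strict_mono_on {1..N} x}"

definition total_variation :: "(real \<Rightarrow> real) \<Rightarrow> ennreal" where
  "total_variation f =
     (SUP (N, x)\<in>partitions. ennreal (\<Sum>n = 1..<N. \<bar>f (x (n + 1)) - f (x n)\<bar>))"

definition BV :: "(real \<Rightarrow> real) set" where
  "BV = {f. total_variation f < \<infinity>}"

text \<open>
  The norm is extended-valued: it is infinite off \<open>BV\<close>, and on \<open>BV\<close> the limit at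
  \<open>-\<infinity>\<close> exists, so that \<open>Lim\<close> is meaningful there.
\<close>

definition BV_norm :: "(real \<Rightarrow> real) \<Rightarrow> ennreal" where
  "BV_norm f = ennreal \<bar>Lim at_bot f\<bar> + total_variation f"

definition riesz_variation :: "real \<Rightarrow> (real \<Rightarrow> real) \<Rightarrow> ennreal" where
  "riesz_variation q g =
     (SUP (N, x)\<in>partitions.
        ennreal ((\<Sum>n = 1..<N. \<bar>g (x (n + 1)) - g (x n)\<bar> powr q / \<bar>x (n + 1) - x n\<bar> powr (q - 1))
                 powr (1 / q)))"

definition frac_maximal :: "real \<Rightarrow> (real \<Rightarrow> real) \<Rightarrow> real \<Rightarrow> ennreal" where
  "frac_maximal \<beta> f x =
     (SUP r\<in>{0<..}. ennreal (1 / (2 * r) powr (1 - \<beta>)) *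
                    (\<integral>\<^sup>+y\<in>{x - r..x + r}. ennreal \<bar>f y\<bar> \<partial>lborel))"

end

theory Submission
  imports Defs "HOL-Real_Asymp.Real_Asymp"
begin

text \<open>
  The operator is applied to \<open>f = \<chi>\<^bsub>[-1,1]\<^esub>\<close> perturbed by a very low and very wide plateau
  \<open>c \<chi>\<^bsub>[-R,R]\<^esub>\<close>. The variation norm of the plateau is at most \<open>2c\<close>, whatever \<open>R\<close> is, but as soon
  as \<open>c R\<^sup>\<beta>\<close> is large the maximal function near the origin is realised by radii of order \<open>R\<close> and
  hence is almost constant there: its oscillation between \<open>0\<close> and \<open>5\<close> tends to \<open>0\<close>, while
  \<open>M\<^sub>\<beta> f\<close> has \<open>M\<^sub>\<beta> f(5) < M\<^sub>\<beta> f(0)\<close>. The two points \<open>0\<close> and \<open>5\<close> alone then bound the Riesz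
  variation of the difference from below.
\<close>

section \<open>Plateaus and their variation norm\<close>

definition plateau :: "real \<Rightarrow> real \<Rightarrow> real \<Rightarrow> real" where
  "plateau c R y = indicator {-1..1} y + c * indicator {-R..R} y"

text \<open>Each increment of \<open>g - h\<close> is dominated by the increment of the
  nondecreasing function \<open>g + h\<close>, and these telescope. As \<open>g + h\<close> takes
  values between 0 and \<open>2 * B\<close>, so does the total.\<close>

lemma total_variation_mono_diff_le:
  assumes g: "mono g" "\<And>x. 0 \<le> g x" "\<And>x. g x \<le> B"
    and h: "mono h" "\<And>x. 0 \<le> h x" "\<And>x. h x \<le> B"
  shows "total_variation (\<lambda>x. g x - h x) \<le> ennreal (2 * B)"
  unfolding total_variation_def
proof (rule SUP_least, clarify)
  fix N :: nat and x :: "nat \<Rightarrow> real"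
  assume "(N, x) \<in> partitions"
  then have N: "1 \<le> N" and x: "strict_mono_on {1..N} x" by (auto simp: partitions_def)
  let ?s = "\<lambda>n. g (x n) + h (x n)"
  have "(\<Sum>n = 1..<N. \<bar>g (x (n + 1)) - h (x (n + 1)) - (g (x n) - h (x n))\<bar>)
      \<le> (\<Sum>n = 1..<N. ?s (Suc n) - ?s n)"
  proof (rule sum_mono)
    fix n assume n: "n \<in> {1..<N}"
    then have "x n \<le> x (Suc n)"
      using x by (auto simp: strict_mono_on_def less_imp_le)
    then have "g (x n) \<le> g (x (Suc n))" "h (x n) \<le> h (x (Suc n))"
      using g(1) h(1) by (auto dest: monoD)
    then show "\<bar>g (x (n + 1)) - h (x (n + 1)) - (g (x n) - h (x n))\<bar> \<le> ?s (Suc n) - ?s n"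
      by simp
  qed
  also have "\<dots> = ?s N - ?s 1"
    using N by (rule sum_Suc_diff')
  also have "\<dots> \<le> 2 * B"
    using g(2)[of "x 1"] h(2)[of "x 1"] g(3)[of "x N"] h(3)[of "x N"] by simp
  finally show "ennreal (\<Sum>n = 1..<N. \<bar>g (x (n + 1)) - h (x (n + 1)) - (g (x n) - h (x n))\<bar>)
      \<le> ennreal (2 * B)"
    by (rule ennreal_leI)
qed

lemma indicator_Icc_eq_diff:
  fixes a b x :: real
  assumes "a \<le> b"
  shows "indicator {a..b} x = (indicator {a..} x - indicator {b<..} x :: real)"
  using assms by (auto simp: indicator_def)

lemma mono_indicator_real [simp]:
  fixes a :: real
  shows "mono (indicator {a..} :: real \<Rightarrow> real)" "mono (indicator {a<..} :: real \<Rightarrow> real)"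
  by (auto simp: mono_def indicator_def)

lemma total_variation_scaled_indicator_le:
  assumes "0 \<le> c" "0 \<le> R"
  shows "total_variation (\<lambda>x. c * indicator {-R..R} x) \<le> ennreal (2 * c)"
proof -
  have "(\<lambda>x. c * indicator {-R..R} x)
      = (\<lambda>x. c * indicator {-R..} x - c * indicator {R<..} x)"
    using assms by (auto simp: indicator_Icc_eq_diff right_diff_distrib)
  moreover have "total_variation (\<lambda>x. c * indicator {-R..} x - c * indicator {R<..} x)
      \<le> ennreal (2 * c)"
    by (rule total_variation_mono_diff_le)
       (use assms in \<open>auto intro!: monoI mult_left_mono simp: indicator_def\<close>)
  ultimately show ?thesis by simp
qed

text \<open>To the left of \<open>-R\<close> the function vanishes, so the limit term of the norm is
  0 and only the two jumps count. The bound is free of \<open>R\<close>: the width can grow at will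
  while the height tends to 0.\<close>

lemma BV_norm_scaled_indicator_le:
  assumes "0 \<le> c" "0 \<le> R"
  shows "BV_norm (\<lambda>x. c * indicator {-R..R} x) \<le> ennreal (2 * c)"
proof -
  have "\<forall>\<^sub>F x in at_bot. c * indicator {-R..R} x = 0"
    using eventually_gt_at_bot[of "-R"] by eventually_elim (auto simp: indicator_def)
  then have "((\<lambda>x. c * indicator {-R..R} x) \<longlongrightarrow> 0) at_bot"
    by (rule tendsto_eventually)
  then have "Lim at_bot (\<lambda>x. c * indicator {-R..R} x) = 0"
    by (intro tendsto_Lim) auto
  then show ?thesis
    using total_variation_scaled_indicator_le[OF assms] by (simp add: BV_norm_def)
qed

lemma plateau_in_BV:
  assumes "0 \<le> c" "0 \<le> R"
  shows "plateau c R \<in> BV"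
proof -
  \<comment> \<open>The upward jumps, at -1 and \<open>-R\<close>, go into one nondecreasing
    function, the downward jumps into another; both are bounded by \<open>1 + c\<close>.\<close>
  have "plateau c R = (\<lambda>x. (indicator {-1..} x + c * indicator {-R..} x)
      - (indicator {1<..} x + c * indicator {R<..} x))"
    using assms by (auto simp: plateau_def indicator_Icc_eq_diff algebra_simps)
  moreover have "total_variation (\<lambda>x. (indicator {-1..} x + c * indicator {-R..} x)
      - (indicator {1<..} x + c * indicator {R<..} x)) \<le> ennreal (2 * (1 + c))"
    by (rule total_variation_mono_diff_le)
       (use assms in \<open>auto intro!: monoI add_mono mult_left_mono simp: indicator_def\<close>)
  ultimately show ?thesis
    by (auto simp: BV_def intro: le_less_trans)
qed

section \<open>Bounds for the maximal function of a plateau\<close>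

lemma nn_integral_plateau:
  assumes "0 \<le> c"
  shows "(\<integral>\<^sup>+y\<in>{x - r..x + r}. ennreal \<bar>plateau c R y\<bar> \<partial>lborel)
     = emeasure lborel ({x - r..x + r} \<inter> {-1..1})
       + ennreal c * emeasure lborel ({x - r..x + r} \<inter> {-R..R})"
proof -
  have "(\<integral>\<^sup>+y\<in>{x - r..x + r}. ennreal \<bar>plateau c R y\<bar> \<partial>lborel)
     = (\<integral>\<^sup>+y. indicator ({x - r..x + r} \<inter> {-1..1}) y
             + ennreal c * indicator ({x - r..x + r} \<inter> {-R..R}) y \<partial>lborel)"
    using assms
    by (intro nn_integral_cong) (auto simp: plateau_def indicator_def)
  then show ?thesis
    by (simp add: nn_integral_add nn_integral_cmult)
qed

lemma emeasure_Icc_Int_le: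
  assumes "0 \<le> r" "0 \<le> R"
  shows "emeasure lborel ({x - r..x + r} \<inter> {-R..R}) \<le> ennreal (min (2 * R) (2 * r))"
proof -
  have "emeasure lborel ({x - r..x + r} \<inter> {-R..R}) \<le> emeasure lborel {x - r..x + r}"
       "emeasure lborel ({x - r..x + r} \<inter> {-R..R}) \<le> emeasure lborel {-R..R}"
    by (auto intro!: emeasure_mono)
  then show ?thesis using assms by (auto simp: min_def)
qed

text \<open>An interval of length \<open>2 * r\<close> meets \<open>[-R, R]\<close> in measure at
  most \<open>min (2 * R) (2 * r)\<close>, wherever its centre is. This turns the supremum into a
  real inequality in \<open>r\<close> alone, uniform in \<open>x\<close>.\<close>

lemma frac_maximal_plateau_le:
  assumes "0 \<le> c" "0 \<le> R" "0 \<le> B"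
    and bound: "\<And>r. 0 < r \<Longrightarrow>
      (min 2 (2 * r) + c * min (2 * R) (2 * r)) * (2 * r) powr (\<beta> - 1) \<le> B"
  shows "frac_maximal \<beta> (plateau c R) x \<le> ennreal B"
  unfolding frac_maximal_def
proof (rule SUP_least)
  fix r :: real assume "r \<in> {0<..}"
  then have r: "0 < r" by simp
  have "emeasure lborel ({x - r..x + r} \<inter> {-1..1})
        + ennreal c * emeasure lborel ({x - r..x + r} \<inter> {-R..R})
      \<le> ennreal (min 2 (2 * r)) + ennreal c * ennreal (min (2 * R) (2 * r))"
    using emeasure_Icc_Int_le[of r 1 x] emeasure_Icc_Int_le[of r R x] r assms(2)
    by (intro add_mono mult_left_mono) auto
  also have "\<dots> = ennreal (min 2 (2 * r) + c * min (2 * R) (2 * r))"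
    using r assms by (simp add: ennreal_mult'')
  finally have "ennreal (1 / (2 * r) powr (1 - \<beta>)) *
      (\<integral>\<^sup>+y\<in>{x - r..x + r}. ennreal \<bar>plateau c R y\<bar> \<partial>lborel)
    \<le> ennreal (1 / (2 * r) powr (1 - \<beta>)) * ennreal (min 2 (2 * r) + c * min (2 * R) (2 * r))"
    unfolding nn_integral_plateau[OF assms(1)] by (rule mult_left_mono) simp
  also have "\<dots> = ennreal ((min 2 (2 * r) + c * min (2 * R) (2 * r)) * (2 * r) powr (\<beta> - 1))"
    using powr_minus_divide[of "2 * r" "1 - \<beta>"]
    by (subst ennreal_mult'[symmetric]) (auto simp: mult.commute)
  also have "\<dots> \<le> ennreal B"
    by (rule ennreal_leI) (rule bound[OF r])
  finally show "ennreal (1 / (2 * r) powr (1 - \<beta>)) *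
      (\<integral>\<^sup>+y\<in>{x - r..x + r}. ennreal \<bar>plateau c R y\<bar> \<partial>lborel) \<le> ennreal B" .
qed

text \<open>As a function of \<open>s\<close>, the left side is \<open>s powr \<beta>\<close> up to
  \<open>s = a\<close> and \<open>a * s powr (\<beta> - 1)\<close> afterwards: first nondecreasing,
  then nonincreasing, with its peak at \<open>s = a\<close>.\<close>

lemma min_times_powr_le:
  fixes a s \<beta> :: real
  assumes "0 < a" "0 < s" "0 \<le> \<beta>" "\<beta> \<le> 1"
  shows "min a s * s powr (\<beta> - 1) \<le> a powr \<beta>"
proof (cases "a \<le> s")
  case True
  have "a * s powr (\<beta> - 1) \<le> a * a powr (\<beta> - 1)"
    using True assms by (intro mult_left_mono powr_mono2') auto
  also have "\<dots> = a powr \<beta>" using assms by (simp add: powr_mult_base)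
  finally show ?thesis using True by simp
next
  case False
  have "s * s powr (\<beta> - 1) = s powr \<beta>" using assms by (simp add: powr_mult_base)
  also have "\<dots> \<le> a powr \<beta>" using False assms by (intro powr_mono2) auto
  finally show ?thesis using False by simp
qed

lemma frac_maximal_plateau_finite:
  assumes "0 \<le> c" "0 < R" "0 < \<beta>" "\<beta> < 1"
  shows "frac_maximal \<beta> (plateau c R) x < \<infinity>"
proof -
  have "frac_maximal \<beta> (plateau c R) x \<le> ennreal (2 powr \<beta> + c * (2 * R) powr \<beta>)"
  proof (rule frac_maximal_plateau_le)
    fix r :: real assume r: "0 < r"
    have "min 2 (2 * r) * (2 * r) powr (\<beta> - 1) \<le> 2 powr \<beta>"
      using r assms by (intro min_times_powr_le) auto
    moreover have "c * (min (2 * R) (2 * r) * (2 * r) powr (\<beta> - 1)) \<le> c * (2 * R) powr \<beta>"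
      using r assms by (intro mult_left_mono min_times_powr_le) auto
    ultimately show "(min 2 (2 * r) + c * min (2 * R) (2 * r)) * (2 * r) powr (\<beta> - 1)
        \<le> 2 powr \<beta> + c * (2 * R) powr \<beta>"
      by (simp add: ring_distribs mult.assoc)
  qed (use assms in auto)
  then show ?thesis by (rule le_less_trans) simp
qed

text \<open>The bounds for the narrow and the wide part peak at different radii, so adding both
  peaks would be too crude. Splitting at \<open>2 * r = R\<close> avoids this: for small radii the
  wide part gives at most \<open>c * R powr \<beta>\<close>, for large ones the narrow part gives at
  most \<open>2 * R powr (\<beta> - 1)\<close>.\<close>

lemma frac_maximal_plateau_0_le:
  assumes "0 \<le> c" "1 \<le> R" "0 < \<beta>" "\<beta> < 1"
    and near: "2 powr \<beta> + c * R powr \<beta> \<le> B"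
    and far: "2 * R powr (\<beta> - 1) + c * (2 * R) powr \<beta> \<le> B"
  shows "frac_maximal \<beta> (plateau c R) 0 \<le> ennreal B"
proof (rule frac_maximal_plateau_le)
  have "0 \<le> 2 powr \<beta> + c * R powr \<beta>" using assms by simp
  then show "0 \<le> B" using near by linarith
  fix r :: real assume r: "0 < r"
  show "(min 2 (2 * r) + c * min (2 * R) (2 * r)) * (2 * r) powr (\<beta> - 1) \<le> B"
  proof (cases "2 * r \<le> R")
    case True
    have "min 2 (2 * r) * (2 * r) powr (\<beta> - 1) \<le> 2 powr \<beta>"
      using r assms by (intro min_times_powr_le) auto
    moreover have "c * (min R (2 * r) * (2 * r) powr (\<beta> - 1)) \<le> c * R powr \<beta>"
      using r assms by (intro mult_left_mono min_times_powr_le) auto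
    moreover have "min (2 * R) (2 * r) = min R (2 * r)" using True r by auto
    ultimately show ?thesis using near by (simp add: ring_distribs mult.assoc)
  next
    case False
    have "min 2 (2 * r) * (2 * r) powr (\<beta> - 1) \<le> 2 * R powr (\<beta> - 1)"
      using False r assms by (intro mult_mono powr_mono2') auto
    moreover have "c * (min (2 * R) (2 * r) * (2 * r) powr (\<beta> - 1)) \<le> c * (2 * R) powr \<beta>"
      using r assms by (intro mult_left_mono min_times_powr_le) auto
    ultimately show ?thesis using far by (simp add: ring_distribs mult.assoc)
  qed
qed (use assms in auto)

lemma frac_maximal_plateau_5_ge:
  assumes "0 \<le> c" "5 < R" "\<beta> < 1"
  shows "ennreal (c * (2 * R - 10) powr \<beta>) \<le> frac_maximal \<beta> (plateau c R) 5"
proof -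
  \<comment> \<open>The largest radius for which the interval around 5 stays inside
    \<open>[-R, R]\<close>. The narrow part is discarded.\<close>
  define r where "r = R - 5"
  have r: "0 < r" using assms by (simp add: r_def)
  have "{5 - r..5 + r} \<inter> {-R..R} = {5 - r..5 + r}" using assms by (auto simp: r_def)
  then have "ennreal (c * (2 * r)) \<le> (\<integral>\<^sup>+y\<in>{5 - r..5 + r}. ennreal \<bar>plateau c R y\<bar> \<partial>lborel)"
    unfolding nn_integral_plateau[OF assms(1)] using r assms by (simp add: ennreal_mult)
  then have "ennreal (1 / (2 * r) powr (1 - \<beta>)) * ennreal (c * (2 * r))
    \<le> ennreal (1 / (2 * r) powr (1 - \<beta>)) *
        (\<integral>\<^sup>+y\<in>{5 - r..5 + r}. ennreal \<bar>plateau c R y\<bar> \<partial>lborel)"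
    by (rule mult_left_mono) simp
  also have "\<dots> \<le> frac_maximal \<beta> (plateau c R) 5"
    unfolding frac_maximal_def using r by (intro SUP_upper) auto
  also have "ennreal (1 / (2 * r) powr (1 - \<beta>)) * ennreal (c * (2 * r))
      = ennreal (c * (2 * r) powr \<beta>)"
    using r assms by (simp add: ennreal_mult'[symmetric] powr_diff)
  finally show ?thesis by (simp add: r_def)
qed

section \<open>The unperturbed step at the points 0 and 5\<close>

lemma frac_maximal_step_0_ge:
  "ennreal (2 * 2 powr (\<beta> - 1)) \<le> frac_maximal \<beta> (plateau 0 R) 0"
proof -
  have "ennreal (1 / (2 * 1) powr (1 - \<beta>)) *
        (\<integral>\<^sup>+y\<in>{0 - 1..0 + 1}. ennreal \<bar>plateau 0 R y\<bar> \<partial>lborel)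
      \<le> frac_maximal \<beta> (plateau 0 R) 0"
    unfolding frac_maximal_def by (intro SUP_upper) auto
  moreover have "1 / 2 powr (1 - \<beta>) = 2 powr (\<beta> - 1)"
    using powr_minus_divide[of 2 "1 - \<beta>"] by simp
  ultimately show ?thesis
    unfolding nn_integral_plateau[OF order_refl] by (simp add: ennreal_mult' mult.commute)
qed

text \<open>An interval around 5 reaches \<open>[-1, 1]\<close> only from radius 4 on; then its
  length is at least 8, while the mass it captures is at most 2.\<close>

lemma frac_maximal_step_5_le:
  assumes "\<beta> < 1"
  shows "frac_maximal \<beta> (plateau 0 R) 5 \<le> ennreal (2 * 8 powr (\<beta> - 1))"
  unfolding frac_maximal_def
proof (rule SUP_least)
  fix r :: real assume "r \<in> {0<..}"
  then have r: "0 < r" by simp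
  show "ennreal (1 / (2 * r) powr (1 - \<beta>)) *
        (\<integral>\<^sup>+y\<in>{5 - r..5 + r}. ennreal \<bar>plateau 0 R y\<bar> \<partial>lborel) \<le> ennreal (2 * 8 powr (\<beta> - 1))"
  proof (cases "r < 4")
    case True
    then have "{5 - r..5 + r} \<inter> {-1..1} = {}" by auto
    then show ?thesis unfolding nn_integral_plateau[OF order_refl] by simp
  next
    case False
    have "emeasure lborel ({5 - r..5 + r} \<inter> {-1..1}) \<le> ennreal 2"
      using emeasure_Icc_Int_le[of r 1 5] r False by simp
    then have "ennreal (1 / (2 * r) powr (1 - \<beta>)) *
        (\<integral>\<^sup>+y\<in>{5 - r..5 + r}. ennreal \<bar>plateau 0 R y\<bar> \<partial>lborel)
      \<le> ennreal ((2 * r) powr (\<beta> - 1)) * ennreal 2"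
      unfolding nn_integral_plateau[OF order_refl]
      using powr_minus_divide[of "2 * r" "1 - \<beta>"] by (simp add: mult_left_mono)
    also have "\<dots> = ennreal ((2 * r) powr (\<beta> - 1) * 2)"
      by (rule ennreal_mult[symmetric]) auto
    also have "\<dots> \<le> ennreal (2 * 8 powr (\<beta> - 1))"
      using False assms powr_mono2'[of "\<beta> - 1" 8 "2 * r"] by (intro ennreal_leI) simp
    finally show ?thesis .
  qed
qed

section \<open>Comparing two points for wide plateaus\<close>

lemma riesz_variation_two_points_le:
  assumes "a < b"
  shows "ennreal ((\<bar>g b - g a\<bar> powr q / \<bar>b - a\<bar> powr (q - 1)) powr (1 / q)) \<le> riesz_variation q g"
proof -
  define x where "x n = (if n \<le> (1::nat) then a else b)" for n
  have "(2, x) \<in> partitions"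
    using assms by (auto simp: partitions_def strict_mono_on_def x_def)
  then have "(\<lambda>(N, x). ennreal ((\<Sum>n = 1..<N. \<bar>g (x (n + 1)) - g (x n)\<bar> powr q
      / \<bar>x (n + 1) - x n\<bar> powr (q - 1)) powr (1 / q))) (2, x) \<le> riesz_variation q g"
    unfolding riesz_variation_def by (intro SUP_upper) auto
  moreover have "{1..<2::nat} = {1}" by auto
  ultimately show ?thesis by (simp add: x_def)
qed

text \<open>Split off one factor \<open>x + y\<close>; the remaining exponent \<open>p - 1\<close>
  is nonpositive, so shrinking the base to \<open>x\<close> or to \<open>y\<close> only increases
  the power.\<close>

lemma powr_add_le:
  fixes x y p :: real
  assumes "0 < x" "0 < y" "0 \<le> p" "p \<le> 1"
  shows "(x + y) powr p \<le> x powr p + y powr p"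
proof -
  have "(x + y) powr p = x * (x + y) powr (p - 1) + y * (x + y) powr (p - 1)"
    using assms powr_mult_base[of "x + y" "p - 1"] by (simp flip: distrib_right)
  also have "\<dots> \<le> x * x powr (p - 1) + y * y powr (p - 1)"
    using assms by (intro add_mono mult_left_mono powr_mono2') auto
  also have "\<dots> = x powr p + y powr p"
    using assms by (simp add: powr_mult_base)
  finally show ?thesis .
qed

text \<open>Both radius ranges at 0 are compared with the same lower bound
  \<open>c * (2 * R - 10) powr \<beta>\<close> at 5. By \<open>near\<close>, small radii do not
  exceed it; by \<open>far\<close>, large radii exceed it by at most
  \<open>\<epsilon>\<close>.\<close>

lemma frac_maximal_plateau_oscillation_le:
  assumes c: "0 \<le> c" and R: "20 \<le> R" and \<beta>: "0 < \<beta>" "\<beta> < 1" and e: "0 \<le> \<epsilon>"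
    and near: "2 powr \<beta> + c * R powr \<beta> \<le> c * (3/2 * R) powr \<beta>"
    and far: "2 * R powr (\<beta> - 1) + c * 10 powr \<beta> \<le> \<epsilon>"
  shows "enn2real (frac_maximal \<beta> (plateau c R) 0)
    \<le> enn2real (frac_maximal \<beta> (plateau c R) 5) + \<epsilon>"
proof -
  let ?L = "c * (2 * R - 10) powr \<beta>"
  \<comment> \<open>Here \<open>20 \<le> R\<close> enters, as
    \<open>3/2 * R \<le> 2 * R - 10\<close>.\<close>
  have "c * (3/2 * R) powr \<beta> \<le> ?L"
    using c R \<beta> by (intro mult_left_mono powr_mono2) auto
  moreover have "c * (2 * R) powr \<beta> \<le> ?L + c * 10 powr \<beta>"
    using powr_add_le[of "2 * R - 10" 10 \<beta>] c R \<beta>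
    by (simp flip: distrib_left) (intro mult_left_mono, auto)
  ultimately have "frac_maximal \<beta> (plateau c R) 0 \<le> ennreal (?L + \<epsilon>)"
    using near far c R \<beta> e by (intro frac_maximal_plateau_0_le) auto
  then have "enn2real (frac_maximal \<beta> (plateau c R) 0) \<le> ?L + \<epsilon>"
    using c e by (intro enn2real_leI) auto
  moreover have "?L \<le> enn2real (frac_maximal \<beta> (plateau c R) 5)"
  proof -
    \<comment> \<open>Since \<open>enn2real\<close> sends infinity to 0, it preserves this
      inequality only if the larger side is finite.\<close>
    have "frac_maximal \<beta> (plateau c R) 5 < top"
      using frac_maximal_plateau_finite[of c R \<beta> 5] c R \<beta> by simp
    then have "enn2real (ennreal ?L) \<le> enn2real (frac_maximal \<beta> (plateau c R) 5)"
      using c R \<beta> by (intro enn2real_mono frac_maximal_plateau_5_ge) auto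
    then show ?thesis using c by simp
  qed
  ultimately show ?thesis by linarith
qed

section \<open>Choice of heights and widths, and the counterexample\<close>

theorem theorem4:
  fixes \<beta> q :: real
  assumes "0 < \<beta>" and "\<beta> < 1" and "q = 1 / (1 - \<beta>)"
  shows "\<exists>(F :: nat \<Rightarrow> real \<Rightarrow> real) (f :: real \<Rightarrow> real).
           (\<forall>j\<ge>1. F j \<in> BV) \<and> f \<in> BV \<and>
           (\<lambda>j. BV_norm (\<lambda>x. F j x - f x)) \<longlonglongrightarrow> 0 \<and>
           (\<forall>j\<ge>1. \<forall>x. frac_maximal \<beta> (F j) x < \<infinity>) \<and>
           (\<forall>x. frac_maximal \<beta> f x < \<infinity>) \<and>
           \<not> (\<lambda>j. riesz_variation q
                   (\<lambda>x. enn2real (frac_maximal \<beta> (F j) x) - enn2real (frac_maximal \<beta> f x)))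
              \<longlonglongrightarrow> 0"
proof -
  define c where "c j = 1 / real (Suc j)" for j
  \<comment> \<open>The exponent makes \<open>R j powr \<beta>\<close> the square of
    \<open>Suc j\<close>, so that \<open>c j * R j powr \<beta>\<close> tends to infinity although
    \<open>c j\<close> tends to 0.\<close>
  define R where "R j = real (Suc j) powr (2 / \<beta>)" for j
  define F where "F j = plateau (c j) (R j)" for j
  \<comment> \<open>Height 0 leaves the indicator of \<open>[-1, 1]\<close>, so the plateau lemmas
    cover the limit function as well.\<close>
  define f where "f = plateau 0 1"
  define d where "d = 2 * 2 powr (\<beta> - 1) - 2 * 8 powr (\<beta> - 1)"
  have c: "0 \<le> c j" and R: "0 < R j" for j by (auto simp: c_def R_def)
  have q: "1 < q" using assms by simp
  have d: "0 < d"
    using assms powr_less_mono2_neg[of "\<beta> - 1" 2 8] by (simp add: d_def)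
  have "(\<lambda>j. ennreal (2 * c j)) \<longlonglongrightarrow> ennreal 0"
    unfolding c_def by (intro tendsto_ennrealI) real_asymp
  then have "(\<lambda>j. ennreal (2 * c j)) \<longlonglongrightarrow> 0" by simp
  moreover have "BV_norm (\<lambda>x. F j x - f x) \<le> ennreal (2 * c j)" for j
    using BV_norm_scaled_indicator_le[OF c less_imp_le[OF R], of j j]
    by (simp add: F_def f_def plateau_def)
  ultimately have norm: "(\<lambda>j. BV_norm (\<lambda>x. F j x - f x)) \<longlonglongrightarrow> 0"
    by - (rule tendsto_sandwich[OF _ _ tendsto_const], auto)

  define G where "G j x = enn2real (frac_maximal \<beta> (F j) x) - enn2real (frac_maximal \<beta> f x)" for j x
  \<comment> \<open>The two-point Riesz quotient for the points 0 and 5, at distance 5, and an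
    increment of size \<open>d/2\<close>.\<close>
  define K where "K = ((d/2) powr q / 5 powr (q - 1)) powr (1 / q)"
  have "0 < K" using d by (simp add: K_def)
  have f_osc: "enn2real (frac_maximal \<beta> f 5) + d \<le> enn2real (frac_maximal \<beta> f 0)"
  proof -
    have "frac_maximal \<beta> f 0 < top"
      using frac_maximal_plateau_finite[of 0 1 \<beta> 0] assms by (simp add: f_def)
    then have "enn2real (ennreal (2 * 2 powr (\<beta> - 1))) \<le> enn2real (frac_maximal \<beta> f 0)"
      unfolding f_def by (intro enn2real_mono frac_maximal_step_0_ge) auto
    moreover have "enn2real (frac_maximal \<beta> f 5) \<le> 2 * 8 powr (\<beta> - 1)"
      unfolding f_def using assms by (intro enn2real_leI frac_maximal_step_5_le) auto
    ultimately show ?thesis by (simp add: d_def)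
  qed
  have cR: "c j * R j powr \<beta> = real (Suc j)" for j
    using assms by (simp add: c_def R_def powr_powr power2_eq_square)
  \<comment> \<open>With \<open>c j * R j powr \<beta> = Suc j\<close>, the condition
    \<open>near\<close> reads \<open>2 powr \<beta> \<le> ((3/2) powr \<beta> - 1) * Suc j\<close>,
    whose right side grows linearly with positive slope.\<close>
  have "1 < (3/2) powr \<beta>" using assms by simp
  then have "filterlim (\<lambda>j. ((3/2) powr \<beta> - 1) * real (Suc j)) at_top sequentially"
    by real_asymp
  then have "\<forall>\<^sub>F j in sequentially. 2 powr \<beta> \<le> ((3/2) powr \<beta> - 1) * real (Suc j)"
    by (simp add: filterlim_at_top)
  then have near: "\<forall>\<^sub>F j in sequentially.
      2 powr \<beta> + c j * R j powr \<beta> \<le> c j * (3/2 * R j) powr \<beta>"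
  proof eventually_elim
    case (elim j)
    have "c j * (3/2 * R j) powr \<beta> = (3/2) powr \<beta> * (c j * R j powr \<beta>)"
      using R[of j] by (subst powr_mult) (auto simp: mult_ac)
    then show ?case using elim cR[of j] by (simp add: algebra_simps)
  qed
  have R_lim: "filterlim R at_top sequentially"
    unfolding R_def
    by (rule filterlim_compose[OF real_powr_at_top]) (use assms in simp, real_asymp)
  have "((\<lambda>t. t powr (\<beta> - 1)) \<longlongrightarrow> 0) at_top"
    using assms by (intro tendsto_neg_powr filterlim_ident) auto
  then have "(\<lambda>j. R j powr (\<beta> - 1)) \<longlonglongrightarrow> 0"
    using R_lim by (rule filterlim_compose)
  moreover have "c \<longlonglongrightarrow> 0" unfolding c_def by real_asymp
  ultimately have "(\<lambda>j. 2 * R j powr (\<beta> - 1) + c j * 10 powr \<beta>) \<longlonglongrightarrow> 2 * 0 + 0 * 10 powr \<beta>"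
    by (intro tendsto_intros)
  then have far: "\<forall>\<^sub>F j in sequentially. 2 * R j powr (\<beta> - 1) + c j * 10 powr \<beta> < d / 2"
    using d by (intro order_tendstoD(2)) auto
  have "\<forall>\<^sub>F j in sequentially. 20 \<le> R j"
    using R_lim by (simp add: filterlim_at_top)
  with near far have low: "\<forall>\<^sub>F j in sequentially. ennreal K \<le> riesz_variation q (G j)"
  proof eventually_elim
    case (elim j)
    have "enn2real (frac_maximal \<beta> (F j) 0) \<le> enn2real (frac_maximal \<beta> (F j) 5) + d / 2"
      unfolding F_def using elim assms c d by (intro frac_maximal_plateau_oscillation_le) auto
    \<comment> \<open>From 0 to 5 the maximal function of \<open>f\<close> drops by at least
      \<open>d\<close>, that of \<open>F j\<close> by at most \<open>d / 2\<close>; so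
      \<open>G j\<close> rises by at least \<open>d / 2\<close>.\<close>
    then have "d / 2 \<le> \<bar>G j 5 - G j 0\<bar>"
      using f_osc unfolding G_def by linarith
    then have "K \<le> (\<bar>G j 5 - G j 0\<bar> powr q / \<bar>5 - 0\<bar> powr (q - 1)) powr (1 / q)"
      using d q by (auto simp: K_def intro!: powr_mono2 divide_right_mono)
    then have "ennreal K \<le> ennreal ((\<bar>G j 5 - G j 0\<bar> powr q / \<bar>5 - 0\<bar> powr (q - 1)) powr (1 / q))"
      by (rule ennreal_leI)
    also have "\<dots> \<le> riesz_variation q (G j)"
      by (rule riesz_variation_two_points_le) simp
    finally show ?case .
  qed
  have "\<not> (\<lambda>j. riesz_variation q (G j)) \<longlonglongrightarrow> 0"
  proof
    assume "(\<lambda>j. riesz_variation q (G j)) \<longlonglongrightarrow> 0"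
    then have "\<forall>\<^sub>F j in sequentially. riesz_variation q (G j) < ennreal K"
      using \<open>0 < K\<close> by (intro order_tendstoD(2)) auto
    with low have "\<forall>\<^sub>F j in sequentially. False"
      by eventually_elim auto
    then show False by simp
  qed
  then have "\<not> (\<lambda>j. riesz_variation q
       (\<lambda>x. enn2real (frac_maximal \<beta> (F j) x) - enn2real (frac_maximal \<beta> f x))) \<longlonglongrightarrow> 0"
    by (simp add: G_def[abs_def])
  moreover have "F j \<in> BV" "f \<in> BV" for j
    using plateau_in_BV c less_imp_le[OF R] by (auto simp: F_def f_def)
  moreover have "frac_maximal \<beta> (F j) x < \<infinity>" "frac_maximal \<beta> f x < \<infinity>" for j x
    using frac_maximal_plateau_finite c R assms unfolding F_def f_def by auto
  ultimately show ?thesis using norm by blast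
qed

end
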